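(* Let $N\ge 2$ and $k\in\mathbb{R}$. Let $\mathcal G$ be a unit weighted digraph on $N$ vertices, without self-loops, which contains a directed spanning tree and whose Laplace matrix has real spectrum. Consider the network of $N$ agents $$\dot x_i=Ax_i+Bu_i,\qquad y_i=C^{\mathrm T}x_i,\qquad i=1,\dots,N,$$ $$A=\begin{pmatrix}0&0\\1&0\end{pmatrix},\quad B=\begin{pmatrix}2\\0\end{pmatrix},\quad C=\begin{pmatrix}0.5\\0.5\end{pmatrix},$$ whose information flow is described by $\mathcal G$, with the controller $$u_i(t)=-k\sum_{j\in\mathcal N_i}(y_i(t)-y_j(t)),\qquad i=1,\dots,N.$$ Then the controller ensures $$\lim_{t\to\infty}(x_i(t)-x_j(t))=0,\quad i,j=1,\dots,N,$$ for all initial conditions $x_1(0),\dots,x_N(0)\in\mathbb{R}^2$ if, and only if, $k>0$.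
   Context: Digraph conventions: a digraph is $\mathcal G=(\mathcal V,\mathcal E)$ with $\mathcal E\subseteq\mathcal V\times\mathcal V$ and no self-loops. In an arc $(\alpha,\beta)$ the vertex $\beta$ is called the parent (neighbour) of $\alpha$; agents are identified with vertices $1,\dots,N$ and $\mathcal N_i=\{j:(i,j)\in\mathcal E\}$ is the set of neighbours of agent $i$. A directed tree is a digraph in which all vertices except one (the root) have exactly one parent; a directed spanning tree of $\mathcal G$ is a directed tree formed by all vertices of $\mathcal G$ and some of its arcs such that there is a directed path (following arcs $(\alpha,\beta)$ from $\alpha$ to $\beta$) from every vertex to the root. Unit weighted: the adjacency matrix $\mathcal A(\mathcal G)$ has $(i,j)$ entry $1$ if $(i,j)\in\mathcal E$ and $0$ otherwise. The Laplace matrix is $L=\mathrm{diag}(\mathcal A(\mathcal G)\mathbf 1_N)-\mathcal A(\mathcal G)$, where $\mathbf 1_N$ is the all-ones vector. *)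

theory Defs
  imports
    "HOL-Analysis.Analysis"
    "Jordan_Normal_Form.Spectral_Radius"
    "Graph_Theory.Digraph_Component"
begin

text \<open>
  An arc \<open>(i, j)\<close> points from \<open>i\<close> to its parent \<open>j\<close>: agent \<open>i\<close> receives information from \<open>j\<close>.
\<close>

definition neighbours :: "'a pair_pre_digraph \<Rightarrow> 'a \<Rightarrow> 'a set" where
  "neighbours G i = {j. (i, j) \<in> parcs G}"

text \<open>
  Arcs are directed towards the root, so the number of parents of a vertex is its out-degree;
  the root has no parent.
\<close>

definition directed_tree :: "'a pair_pre_digraph \<Rightarrow> 'a \<Rightarrow> bool" where
  "directed_tree T r \<longleftrightarrow>
     pair_digraph T \<and> r \<in> pverts T \<and> out_degree (with_proj T) r = 0 \<and>
     (\<forall>v \<in> pverts T - {r}. out_degree (with_proj T) v = 1)"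

definition contains_directed_spanning_tree :: "'a pair_pre_digraph \<Rightarrow> bool" where
  "contains_directed_spanning_tree G \<longleftrightarrow>
     (\<exists>T r. directed_tree T r \<and> spanning (with_proj T) (with_proj G) \<and>
            (\<forall>v \<in> pverts G. v \<rightarrow>\<^sup>*\<^bsub>with_proj T\<^esub> r))"

text \<open>
  Since matrix indices of type \<^typ>\<open>'a Matrix.mat\<close> start at \<open>0\<close>, the vertices of a digraph on
  \<open>N\<close> vertices are numbered \<open>0, \<dots>, N - 1\<close>.
\<close>

definition adjacency_matrix :: "nat \<Rightarrow> nat pair_pre_digraph \<Rightarrow> real Matrix.mat" where
  "adjacency_matrix N G = Matrix.mat N N (\<lambda>(i, j). if (i, j) \<in> parcs G then 1 else 0)"

definition laplace_matrix :: "nat \<Rightarrow> nat pair_pre_digraph \<Rightarrow> real Matrix.mat" where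
  "laplace_matrix N G =
     mat_diag N (Matrix.vec_index (adjacency_matrix N G *\<^sub>v Matrix.vec N (\<lambda>_. 1)))
       - adjacency_matrix N G"

definition has_real_spectrum :: "real Matrix.mat \<Rightarrow> bool" where
  "has_real_spectrum M \<longleftrightarrow> spectrum (map_mat complex_of_real M) \<subseteq> \<real>"

text \<open>
  State, input and output trajectories of the single-input single-output agents under the
  diffusive static output feedback with gain \<open>k\<close>, on the time interval \<open>[0, \<infinity>)\<close>.
  The scalar \<open>C\<^sup>T x\<^sub>i\<close> is the inner product of the column vectors \<open>C\<close> and \<open>x\<^sub>i\<close>.
\<close>

definition closed_loop ::
  "'a pair_pre_digraph \<Rightarrow> real^'n^'n \<Rightarrow> real^'n \<Rightarrow> real^'n \<Rightarrow> real \<Rightarrow>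
   ('a \<Rightarrow> real \<Rightarrow> real^'n) \<Rightarrow> ('a \<Rightarrow> real \<Rightarrow> real) \<Rightarrow> ('a \<Rightarrow> real \<Rightarrow> real) \<Rightarrow> bool" where
  "closed_loop G A B C k x u y \<longleftrightarrow>
     (\<forall>i \<in> pverts G. \<forall>t \<ge> 0.
        (x i has_vector_derivative (A *v x i t + u i t *\<^sub>R B)) (at t within {0..}) \<and>
        y i t = inner C (x i t) \<and>
        u i t = - k * (\<Sum>j \<in> neighbours G i. y i t - y j t))"

definition ensures_synchronization ::
  "'a pair_pre_digraph \<Rightarrow> real^'n^'n \<Rightarrow> real^'n \<Rightarrow> real^'n \<Rightarrow> real \<Rightarrow> bool" where
  "ensures_synchronization G A B C k \<longleftrightarrow>
     (\<forall>x0 x u y.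
        closed_loop G A B C k x u y \<and> (\<forall>i \<in> pverts G. x i 0 = x0 i) \<longrightarrow>
        (\<forall>i \<in> pverts G. \<forall>j \<in> pverts G. ((\<lambda>t. x i t - x j t) \<longlongrightarrow> 0) at_top))"

end

theory Submission
  imports Defs
begin

text \<open>
  Writing \<open>p\<close> and \<open>q\<close> for the vectors of first and second state components, the closed loop is
  \<open>p' = - k L (p + q)\<close>, \<open>q' = p\<close>. The differences to a root \<open>r\<close> of the spanning tree satisfy the same
  equations with a matrix in place of \<open>L\<close> whose spectrum is positive: by the maximum principle for
  the Laplacian, \<open>L v\<close> is a constant vector only if \<open>v\<close> is, and real eigenvalues of \<open>L\<close> are
  nonnegative. After triangularization, back substitution reduces synchronization for \<open>k > 0\<close> to
  scalar equations \<open>z'' + a z' + a z = f\<close> with \<open>a > 0\<close> and \<open>f\<close> vanishing at infinity. Conversely,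
  \<open>L\<close> has positive trace, hence an eigenvalue \<open>c > 0\<close> with a real nonconstant eigenvector \<open>f\<close>;
  if \<open>k \<le> 0\<close> then \<open>s\<^sup>2 + k c s + k c\<close> has a root \<open>s \<ge> 0\<close>, and \<open>q = exp (s t) f\<close>, \<open>p = s q\<close> is a
  trajectory that does not synchronize.
\<close>

no_notation Matrix.vec_index (infixl \<open>$\<close> 100)

subsection \<open>Perturbed stable scalar equations\<close>

text \<open>Once \<open>f\<close> is bounded by \<open>\<delta>\<close> after time \<open>T\<close>,
  the integrating factor bounds \<open>norm (w t)\<close> by a decaying term plus
  \<open>\<delta> / c\<close>. The mean value inequality takes the place of the integral in
  variation of constants.\<close>

lemma perturbed_stable_scalar_ode_tendsto_0:
  fixes w f :: "real \<Rightarrow> complex"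
  assumes mu: "Re \<mu> < 0"
    and der: "\<And>t. t \<ge> 0 \<Longrightarrow> (w has_vector_derivative \<mu> * w t + f t) (at t within {0..})"
    and f: "(f \<longlongrightarrow> 0) at_top"
  shows "(w \<longlongrightarrow> 0) at_top"
proof (rule tendstoI)
  fix \<epsilon> :: real assume eps: "\<epsilon> > 0"
  define c where "c = - Re \<mu>"
  have c: "c > 0" using mu by (simp add: c_def)
  \<comment> \<open>Chosen so that \<open>\<delta> / c = \<epsilon> / 2\<close>; the other half of
    \<open>\<epsilon>\<close> is left for the decaying term.\<close>
  define \<delta> where "\<delta> = \<epsilon> * c / 2"
  have \<delta>: "\<delta> > 0" using eps c by (simp add: \<delta>_def)
  obtain T where T: "T \<ge> 0" "\<And>t. t \<ge> T \<Longrightarrow> norm (f t) \<le> \<delta>"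
  proof -
    obtain T0 where T0: "\<And>t. t \<ge> T0 \<Longrightarrow> dist (f t) 0 < \<delta>"
      using tendstoD[OF f \<delta>] by (auto simp: eventually_at_top_linorder)
    \<comment> \<open>The maximum with 0 keeps all later times inside the domain
      \<open>{0..}\<close> of the equation.\<close>
    show ?thesis
      by (rule that[of "max T0 0"]) (use T0 in \<open>auto intro: less_imp_le\<close>)
  qed
  \<comment> \<open>Integrating factor: \<open>g' = exp (- \<mu> s) * f\<close>.\<close>
  define g where "g s = exp (s *\<^sub>R (- \<mu>)) * w s" for s
  have norm_exp: "norm (exp (s *\<^sub>R (- \<mu>))) = exp (c * s)" for s
    by (simp add: norm_exp_eq_Re c_def mult.commute)
  have norm_g: "norm (g s) = exp (c * s) * norm (w s)" for s
    unfolding g_def norm_mult norm_exp ..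
  have g_der: "(g has_vector_derivative exp (s *\<^sub>R (- \<mu>)) * f s) (at s within {0..})"
    if "s \<ge> 0" for s
  proof -
    have "(g has_vector_derivative
        exp (s *\<^sub>R (- \<mu>)) * (\<mu> * w s + f s) + exp (s *\<^sub>R (- \<mu>)) * (- \<mu>) * w s) (at s within {0..})"
      unfolding g_def
      by (rule has_vector_derivative_mult[OF exp_scaleR_has_vector_derivative_right der[OF that]])
    then show ?thesis by (simp add: algebra_simps)
  qed
  have bound: "norm (w t) \<le> exp (- c * t) * norm (g T) + \<epsilon> / 2" if t: "t > T" for t
  proof -
    \<comment> \<open>The majorant \<open>\<delta> / c * exp (c * s)\<close> has derivative
      \<open>\<delta> * exp (c * s)\<close>, which dominates the derivative of
      \<open>g\<close>.\<close>
    have "norm (g t - g T) \<le> \<delta> / c * exp (c * t) - \<delta> / c * exp (c * T)"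
    proof (rule differentiable_bound_general[OF t])
      show "continuous_on {T..t} g"
        unfolding continuous_on_eq_continuous_within
      proof
        fix s assume s: "s \<in> {T..t}"
        then have "s \<ge> 0" using T(1) by simp
        from has_vector_derivative_continuous[OF g_der[OF this]]
        show "continuous (at s within {T..t}) g"
          by (rule continuous_within_subset) (use T(1) in auto)
      qed
      show "continuous_on {T..t} (\<lambda>s. \<delta> / c * exp (c * s))"
        by (intro continuous_intros)
      fix s assume s: "T < s" "s < t"
      have "at s within {0..} = at s"
        using s T(1) by (intro at_within_interior) simp
      then show "(g has_vector_derivative exp (s *\<^sub>R (- \<mu>)) * f s) (at s)"
        using g_der[of s] s T(1) by simp
      show "((\<lambda>s. \<delta> / c * exp (c * s)) has_vector_derivative \<delta> * exp (c * s)) (at s)"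
        unfolding has_real_derivative_iff_has_vector_derivative[symmetric]
        using c by (auto intro!: derivative_eq_intros)
      show "norm (exp (s *\<^sub>R (- \<mu>)) * f s) \<le> \<delta> * exp (c * s)"
        unfolding norm_mult norm_exp using T(2)[of s] s by (simp add: mult.commute)
    qed
    also have "\<dots> \<le> \<delta> / c * exp (c * t)"
      using c \<delta> by simp
    finally have "norm (g t) \<le> norm (g T) + \<delta> / c * exp (c * t)"
      using norm_triangle_sub[of "g t" "g T"] by linarith
    then have "exp (- c * t) * norm (g t) \<le> exp (- c * t) * (norm (g T) + \<delta> / c * exp (c * t))"
      by simp
    moreover have "exp (- c * t) * exp (c * t) = 1"
      by (simp add: exp_minus)
    moreover have "\<delta> / c = \<epsilon> / 2"
      using c by (simp add: \<delta>_def)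
    ultimately show ?thesis
      by (simp only: norm_g distrib_left mult.assoc[symmetric] mult_1_left mult.commute[of _ "\<epsilon> / 2"])
        (simp add: mult.assoc)
  qed
  have "((\<lambda>t. exp (- c * t) * norm (g T)) \<longlongrightarrow> 0) at_top"
  proof (rule tendsto_mult_left_zero)
    have "filterlim (\<lambda>t. - c * t) at_bot at_top"
      using c by (intro filterlim_tendsto_neg_mult_at_bot[OF tendsto_const _ filterlim_ident]) auto
    then show "((\<lambda>t. exp (- c * t)) \<longlongrightarrow> 0) at_top"
      by (rule filterlim_compose[OF exp_at_bot])
  qed
  from tendstoD[OF this half_gt_zero[OF eps]]
  show "eventually (\<lambda>t. dist (w t) 0 < \<epsilon>) at_top"
    using eventually_gt_at_top[of T]
  proof eventually_elim
    case (elim t)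
    then have "exp (- c * t) * norm (g T) < \<epsilon> / 2" by simp
    with bound[OF elim(2)] have "norm (w t) < \<epsilon>" by linarith
    then show ?case by simp
  qed
qed

text \<open>Vieta form of the roots of \<open>s^2 + a * s + a\<close>. The root \<open>d\<close> of
  the discriminant is either real and smaller than \<open>a\<close> or purely imaginary, so
  \<open>\<bar>Re d\<bar> < a\<close> in both cases.\<close>

lemma stable_quadratic_roots:
  assumes a: "(a::real) > 0"
  obtains \<mu> \<nu> :: complex
  where "\<mu> + \<nu> = - of_real a" "\<mu> * \<nu> = of_real a" "Re \<mu> < 0" "Re \<nu> < 0"
proof -
  define d where "d = csqrt (of_real (a\<^sup>2 - 4 * a))"
  define \<mu> where "\<mu> = (- of_real a + d) / 2"
  define \<nu> where "\<nu> = (- of_real a - d) / 2"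
  have d2: "d * d = of_real (a\<^sup>2 - 4 * a)"
    unfolding d_def using power2_csqrt by (simp only: power2_eq_square[symmetric])
  have "\<bar>Re d\<bar> < a"
  proof (cases "a\<^sup>2 - 4 * a \<ge> 0")
    case True
    then have "Re d = sqrt (a\<^sup>2 - 4 * a)" "sqrt (a\<^sup>2 - 4 * a) \<ge> 0"
      by (simp_all add: d_def)
    moreover have "sqrt (a\<^sup>2 - 4 * a) < a"
      using a by (intro real_less_lsqrt) auto
    ultimately show ?thesis by simp
  next
    case False
    then have "Re d = 0" unfolding d_def by (subst csqrt_of_real_nonpos) auto
    then show ?thesis using a by simp
  qed
  then have "Re \<mu> < 0" "Re \<nu> < 0" by (auto simp: \<mu>_def \<nu>_def)
  moreover have "\<mu> + \<nu> = - of_real a" by (simp add: \<mu>_def \<nu>_def field_simps)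
  moreover have "\<mu> * \<nu> = of_real a"
  proof -
    have "\<mu> * \<nu> = ((of_real a)\<^sup>2 - d * d) / 4"
      by (simp add: \<mu>_def \<nu>_def field_simps power2_eq_square)
    then show ?thesis by (simp add: d2)
  qed
  ultimately show ?thesis using that by blast
qed

text \<open>The characteristic roots split the oscillator into a cascade: the first equation is
  driven by \<open>f\<close>, the second by the vanishing solution of the first. Double roots are
  covered as well.\<close>

lemma perturbed_stable_oscillator_tendsto_0:
  fixes z w f :: "real \<Rightarrow> complex"
  assumes a: "(a::real) > 0"
    and z: "\<And>t. t \<ge> 0 \<Longrightarrow> (z has_vector_derivative w t) (at t within {0..})"
    and w: "\<And>t. t \<ge> 0 \<Longrightarrow>
      (w has_vector_derivative - of_real a * (w t + z t) + f t) (at t within {0..})"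
    and f: "(f \<longlongrightarrow> 0) at_top"
  shows "(z \<longlongrightarrow> 0) at_top" and "(w \<longlongrightarrow> 0) at_top"
proof -
  obtain \<mu> \<nu> :: complex
    where s: "\<mu> + \<nu> = - of_real a" and p: "\<mu> * \<nu> = of_real a" and re: "Re \<mu> < 0" "Re \<nu> < 0"
    using stable_quadratic_roots[OF a] .
  \<comment> \<open>\<open>w - \<mu> z\<close> and \<open>z\<close> solve first-order equations with rates \<open>\<nu>\<close> and \<open>\<mu>\<close>, respectively.\<close>
  have v: "((\<lambda>t. w t - \<mu> * z t) \<longlongrightarrow> 0) at_top"
  proof (rule perturbed_stable_scalar_ode_tendsto_0[OF re(2) _ f])
    fix t :: real assume t: "t \<ge> 0"
    have "((\<lambda>t. w t - \<mu> * z t) has_vector_derivative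
        (- of_real a * (w t + z t) + f t) - \<mu> * w t) (at t within {0..})"
      by (intro has_vector_derivative_diff w z t
          bounded_linear.has_vector_derivative[OF bounded_linear_mult_right])
    also have "(- of_real a * (w t + z t) + f t) - \<mu> * w t = \<nu> * (w t - \<mu> * z t) + f t"
    proof -
      have "- of_real a * (w t + z t) = (\<mu> + \<nu>) * w t - (\<mu> * \<nu>) * z t"
        unfolding s p by (simp add: algebra_simps)
      then show ?thesis by (simp add: algebra_simps)
    qed
    finally show "((\<lambda>t. w t - \<mu> * z t) has_vector_derivative
        \<nu> * (w t - \<mu> * z t) + f t) (at t within {0..})" .
  qed
  show z0: "(z \<longlongrightarrow> 0) at_top"
    by (rule perturbed_stable_scalar_ode_tendsto_0[OF re(1) _ v]) (use z in simp)
  have "((\<lambda>t. (w t - \<mu> * z t) + \<mu> * z t) \<longlongrightarrow> 0 + \<mu> * 0) at_top"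
    by (intro tendsto_intros v z0)
  then show "(w \<longlongrightarrow> 0) at_top" by simp
qed

subsection \<open>Triangularization of linear networks\<close>

text \<open>Schur decomposition, with matrices as index functions so that they can act on families
  of trajectories. The last clause ties the diagonal of \<open>T\<close> to eigenvectors of
  \<open>A\<close>, which is how assumptions on the spectrum enter.\<close>

lemma triangularization:
  fixes A :: "nat \<Rightarrow> nat \<Rightarrow> complex"
  shows "\<exists>P Q T :: nat \<Rightarrow> nat \<Rightarrow> complex.
    (\<forall>i<n. \<forall>j<n. (\<Sum>l=0..<n. P i l * Q l j) = (if i = j then 1 else 0)) \<and>
    (\<forall>i<n. \<forall>j<n. (\<Sum>l=0..<n. Q i l * P l j) = (if i = j then 1 else 0)) \<and>
    (\<forall>i<n. \<forall>j<n. (\<Sum>l=0..<n. Q i l * A l j) = (\<Sum>l=0..<n. T i l * Q l j)) \<and>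
    (\<forall>i<n. \<forall>j<i. T i j = 0) \<and>
    (\<forall>i<n. \<exists>v. (\<exists>j<n. v j \<noteq> 0) \<and> (\<forall>j<n. (\<Sum>l=0..<n. A j l * v l) = T i i * v j))"
proof -
  define A' where "A' = Matrix.mat n n (\<lambda>(i, j). A i j)"
  have A': "A' \<in> carrier_mat n n" by (simp add: A'_def)
  obtain es where es: "char_poly A' = (\<Prod>a\<leftarrow>es. [:- a, 1:])"
    using char_poly_factorized[OF A'] by blast
  obtain B P Q where "schur_decomposition A' es = (B, P, Q)"
    by (cases "schur_decomposition A' es")
  from schur_decomposition[OF A' es this]
  have sim: "similar_mat_wit A' B P Q" and ut: "upper_triangular B" and diag: "diag_mat B = es"
    by auto
  note wit = similar_mat_witD2[OF A' sim]
  \<comment> \<open>The similarity \<open>A' = P * B * Q\<close> in the form needed for the change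
    of coordinates by \<open>Q\<close>.\<close>
  have QA: "Q * A' = B * Q"
  proof -
    have "Q * A' = Q * (P * (B * Q))"
      using wit by (simp add: assoc_mult_mat[of _ n n _ n _ n])
    also have "\<dots> = (Q * P) * (B * Q)"
      using wit by (intro assoc_mult_mat[symmetric]) auto
    finally show ?thesis using wit by simp
  qed
  have entry: "(X * Y) $$ (i, j) = (\<Sum>l=0..<n. X $$ (i, l) * Y $$ (l, j))"
    if "X \<in> carrier_mat n n" "Y \<in> carrier_mat n n" "i < n" "j < n" for X Y :: "complex Matrix.mat" and i j
    using that by (simp add: scalar_prod_def)
  show ?thesis
  proof (rule exI[of _ "\<lambda>i j. P $$ (i, j)"], rule exI[of _ "\<lambda>i j. Q $$ (i, j)"],
      rule exI[of _ "\<lambda>i j. B $$ (i, j)"], intro conjI allI impI)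
    fix i j assume ij: "i < n" "j < n"
    show "(\<Sum>l=0..<n. P $$ (i, l) * Q $$ (l, j)) = (if i = j then 1 else 0)"
      using entry[OF wit(6,7) ij] wit(1) ij by simp
    show "(\<Sum>l=0..<n. Q $$ (i, l) * P $$ (l, j)) = (if i = j then 1 else 0)"
      using entry[OF wit(7,6) ij] wit(2) ij by simp
    have "(\<Sum>l=0..<n. Q $$ (i, l) * A l j) = (\<Sum>l=0..<n. Q $$ (i, l) * A' $$ (l, j))"
      using ij by (intro sum.cong) (auto simp: A'_def)
    then show "(\<Sum>l=0..<n. Q $$ (i, l) * A l j) = (\<Sum>l=0..<n. B $$ (i, l) * Q $$ (l, j))"
      using entry[OF wit(7,4) ij] entry[OF wit(5,7) ij] QA by simp
  next
    fix i j assume "i < n" "j < i"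
    then show "B $$ (i, j) = 0" using ut wit(5) by auto
  next
    fix i assume i: "i < n"
    \<comment> \<open>The diagonal of \<open>B\<close> lists the roots of the characteristic
      polynomial.\<close>
    have "B $$ (i, i) \<in> set es"
      using i wit(5) unfolding diag[symmetric] diag_mat_def by auto
    then have "poly (char_poly A') (B $$ (i, i)) = 0"
      unfolding es by (simp add: poly_prod_list_zero_iff)
    then obtain v where v: "v \<in> carrier_vec n" "v \<noteq> 0\<^sub>v n" "A' *\<^sub>v v = B $$ (i, i) \<cdot>\<^sub>v v"
      using A' unfolding eigenvalue_root_char_poly[OF A', symmetric] eigenvalue_def eigenvector_def
      by auto
    have "\<exists>j<n. vec_index v j \<noteq> 0"
    proof (rule ccontr)
      assume "\<not> ?thesis"
      then have "v = 0\<^sub>v n" using v(1) by (intro eq_vecI) auto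
      with v(2) show False ..
    qed
    moreover have "(\<Sum>l=0..<n. A j l * vec_index v l) = B $$ (i, i) * vec_index v j" if j: "j < n" for j
    proof -
      have "vec_index (A' *\<^sub>v v) j = (\<Sum>l=0..<n. A j l * vec_index v l)"
        using j v(1) by (simp add: A'_def scalar_prod_def)
      then show ?thesis using j v(1) v(3) by simp
    qed
    ultimately show "\<exists>v. (\<exists>j<n. v j \<noteq> 0) \<and> (\<forall>j<n. (\<Sum>l=0..<n. A j l * v l) = B $$ (i, i) * v j)"
      by blast
  qed
qed

text \<open>Similarity invariance of the trace: insert \<open>P Q = 1\<close>, replace
  \<open>Q A\<close> by \<open>T Q\<close>, and contract \<open>Q P = 1\<close>.\<close>

lemma trace_triangularization:
  fixes A P Q T :: "nat \<Rightarrow> nat \<Rightarrow> 'a::comm_ring_1"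
  assumes PQ: "\<And>i j. i < n \<Longrightarrow> j < n \<Longrightarrow> (\<Sum>l=0..<n. P i l * Q l j) = (if i = j then 1 else 0)"
    and QP: "\<And>i j. i < n \<Longrightarrow> j < n \<Longrightarrow> (\<Sum>l=0..<n. Q i l * P l j) = (if i = j then 1 else 0)"
    and QA: "\<And>i j. i < n \<Longrightarrow> j < n \<Longrightarrow> (\<Sum>l=0..<n. Q i l * A l j) = (\<Sum>l=0..<n. T i l * Q l j)"
  shows "(\<Sum>i=0..<n. A i i) = (\<Sum>i=0..<n. T i i)"
proof -
  have "(\<Sum>i=0..<n. A i i) = (\<Sum>i=0..<n. \<Sum>l=0..<n. (if i = l then 1 else 0) * A l i)"
    by (simp add: if_distrib[of "\<lambda>x. x * _"] cong: if_cong)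
  also have "\<dots> = (\<Sum>i=0..<n. \<Sum>l=0..<n. (\<Sum>m=0..<n. P i m * Q m l) * A l i)"
    by (intro sum.cong refl) (simp add: PQ)
  also have "\<dots> = (\<Sum>i=0..<n. \<Sum>l=0..<n. \<Sum>m=0..<n. P i m * (Q m l * A l i))"
    by (simp add: sum_distrib_right mult.assoc)
  also have "\<dots> = (\<Sum>i=0..<n. \<Sum>m=0..<n. \<Sum>l=0..<n. P i m * (Q m l * A l i))"
    by (rule sum.cong[OF refl], rule sum.swap)
  also have "\<dots> = (\<Sum>i=0..<n. \<Sum>m=0..<n. \<Sum>l=0..<n. P i m * (T m l * Q l i))"
    by (simp add: sum_distrib_left[symmetric] QA)
  also have "\<dots> = (\<Sum>m=0..<n. \<Sum>i=0..<n. \<Sum>l=0..<n. P i m * (T m l * Q l i))"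
    by (rule sum.swap)
  also have "\<dots> = (\<Sum>m=0..<n. \<Sum>l=0..<n. \<Sum>i=0..<n. P i m * (T m l * Q l i))"
    by (rule sum.cong[OF refl], rule sum.swap)
  also have "\<dots> = (\<Sum>m=0..<n. \<Sum>l=0..<n. T m l * (\<Sum>i=0..<n. Q l i * P i m))"
    by (simp add: sum_distrib_left mult_ac)
  also have "\<dots> = (\<Sum>m=0..<n. \<Sum>l=0..<n. T m l * (if l = m then 1 else 0))"
    by (intro sum.cong refl) (simp add: QP)
  also have "\<dots> = (\<Sum>i=0..<n. T i i)"
    by (simp add: if_distrib[of "\<lambda>x. _ * x"] cong: if_cong)
  finally show ?thesis .
qed

text \<open>In the coordinates given by \<open>Q\<close> the network is upper triangular: row
  \<open>i\<close> is a scalar oscillator with \<open>a = k * Re (T i i) > 0\<close>, driven only by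
  later rows.\<close>

lemma positive_spectrum_network_tendsto_0:
  fixes M :: "nat \<Rightarrow> nat \<Rightarrow> complex" and e d :: "nat \<Rightarrow> real \<Rightarrow> complex"
  assumes k: "(k::real) > 0"
    and spec: "\<And>v \<mu>. (\<exists>j<n. v j \<noteq> 0) \<Longrightarrow> (\<forall>j<n. (\<Sum>l=0..<n. M j l * v l) = \<mu> * v j)
      \<Longrightarrow> \<mu> \<in> \<real> \<and> Re \<mu> > 0"
    and e: "\<And>i t. i < n \<Longrightarrow> t \<ge> 0 \<Longrightarrow> (e i has_vector_derivative d i t) (at t within {0..})"
    and d: "\<And>i t. i < n \<Longrightarrow> t \<ge> 0 \<Longrightarrow> (d i has_vector_derivative
      - of_real k * (\<Sum>l=0..<n. M i l * (d l t + e l t))) (at t within {0..})"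
    and i: "i < n"
  shows "(e i \<longlongrightarrow> 0) at_top" and "(d i \<longlongrightarrow> 0) at_top"
proof -
  obtain P Q T :: "nat \<Rightarrow> nat \<Rightarrow> complex"
    where "\<forall>i<n. \<forall>j<n. (\<Sum>l=0..<n. P i l * Q l j) = (if i = j then 1 else 0)"
      and "\<forall>i<n. \<forall>j<n. (\<Sum>l=0..<n. Q i l * P l j) = (if i = j then 1 else 0)"
      and "\<forall>i<n. \<forall>j<n. (\<Sum>l=0..<n. Q i l * M l j) = (\<Sum>l=0..<n. T i l * Q l j)"
      and "\<forall>i<n. \<forall>j<i. T i j = 0"
      and "\<forall>i<n. \<exists>v. (\<exists>j<n. v j \<noteq> 0) \<and> (\<forall>j<n. (\<Sum>l=0..<n. M j l * v l) = T i i * v j)"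
    using triangularization[of n M] by (elim exE conjE)
  note PQ = this(1)[rule_format] and QM = this(3)[rule_format]
    and T = this(4)[rule_format] and ev = this(5)[rule_format]
  define z where "z i t = (\<Sum>l=0..<n. Q i l * e l t)" for i t
  define w where "w i t = (\<Sum>l=0..<n. Q i l * d l t)" for i t
  have z: "(z i has_vector_derivative w i t) (at t within {0..})" if "t \<ge> 0" for i t
    unfolding z_def w_def using that
    by (intro has_vector_derivative_sum e
        bounded_linear.has_vector_derivative[OF bounded_linear_mult_right]) auto
  have w: "(w i has_vector_derivative
      - of_real k * (\<Sum>m=0..<n. T i m * (w m t + z m t))) (at t within {0..})"
    if t: "t \<ge> 0" and i: "i < n" for i t
  proof -
    have "(w i has_vector_derivative
        (\<Sum>j=0..<n. Q i j * (- of_real k * (\<Sum>l=0..<n. M j l * (d l t + e l t))))) (at t within {0..})"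
      unfolding w_def using t
      by (intro has_vector_derivative_sum d
          bounded_linear.has_vector_derivative[OF bounded_linear_mult_right]) auto
    also have "(\<Sum>j=0..<n. Q i j * (- of_real k * (\<Sum>l=0..<n. M j l * (d l t + e l t)))) =
        - of_real k * (\<Sum>j=0..<n. \<Sum>l=0..<n. Q i j * M j l * (d l t + e l t))"
      by (simp add: sum_distrib_left sum_negf mult_ac)
    also have "(\<Sum>j=0..<n. \<Sum>l=0..<n. Q i j * M j l * (d l t + e l t)) =
        (\<Sum>l=0..<n. \<Sum>j=0..<n. Q i j * M j l * (d l t + e l t))"
      by (rule sum.swap)
    also have "\<dots> = (\<Sum>l=0..<n. \<Sum>m=0..<n. T i m * Q m l * (d l t + e l t))"
      using i by - (rule sum.cong[OF refl], simp add: sum_distrib_right[symmetric] QM del: mult_cancel_right)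
    also have "\<dots> = (\<Sum>m=0..<n. \<Sum>l=0..<n. T i m * Q m l * (d l t + e l t))"
      by (rule sum.swap)
    also have "\<dots> = (\<Sum>m=0..<n. T i m * (w m t + z m t))"
      unfolding w_def z_def sum.distrib[symmetric] sum_distrib_left
      by (intro sum.cong refl) (simp add: algebra_simps)
    finally show ?thesis .
  qed
  have zw: "(z i \<longlongrightarrow> 0) at_top \<and> (w i \<longlongrightarrow> 0) at_top" if "i < n" for i
    using that
  \<comment> \<open>The measure \<open>n - i\<close> starts the induction at the last row.\<close>
  proof (induction i rule: measure_induct_rule[of "\<lambda>i. n - i"])
    case (less i)
    \<comment> \<open>Coupling to the later rows, which vanishes at infinity by the induction
      hypothesis.\<close>
    define f where "f t = - of_real k * (\<Sum>m\<in>{i<..<n}. T i m * (w m t + z m t))" for t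
    from ev[OF less.prems] obtain v where "\<exists>j<n. v j \<noteq> 0"
      "\<forall>j<n. (\<Sum>l=0..<n. M j l * v l) = T i i * v j" by blast
    from spec[OF this] have Ti: "T i i = of_real (Re (T i i))" "Re (T i i) > 0" by auto
    have f: "(f \<longlongrightarrow> 0) at_top"
    proof -
      have "(f \<longlongrightarrow> - of_real k * (\<Sum>m\<in>{i<..<n}. T i m * (0 + 0))) at_top"
        unfolding f_def using less by (intro tendsto_intros) auto
      then show ?thesis by simp
    qed
    have "(w i has_vector_derivative
        - of_real (k * Re (T i i)) * (w i t + z i t) + f t) (at t within {0..})" if t: "t \<ge> 0" for t
    proof -
      have "{0..<n} = {0..<i} \<union> insert i {i<..<n}" using less.prems by auto
      then have "(\<Sum>m=0..<n. T i m * (w m t + z m t)) =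
          (\<Sum>m=0..<i. T i m * (w m t + z m t)) + (\<Sum>m\<in>insert i {i<..<n}. T i m * (w m t + z m t))"
        by (simp only:) (rule sum.union_disjoint, auto)
      also have "(\<Sum>m=0..<i. T i m * (w m t + z m t)) = 0"
        using T[OF less.prems] by simp
      finally have "- of_real k * (\<Sum>m=0..<n. T i m * (w m t + z m t)) =
          - of_real k * T i i * (w i t + z i t) + f t"
        by (simp add: f_def algebra_simps)
      also have "\<dots> = - of_real (k * Re (T i i)) * (w i t + z i t) + f t"
        by (subst Ti(1)) simp
      finally show ?thesis using w[OF t less.prems] by simp
    qed
    from perturbed_stable_oscillator_tendsto_0[OF _ z this f] k Ti(2)
    show ?case by simp
  qed
  \<comment> \<open>\<open>P\<close> undoes the change of coordinates, so the limits of
    \<open>z\<close> and \<open>w\<close> pass to \<open>e\<close> and \<open>d\<close>.\<close>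
  have recover: "(\<Sum>m=0..<n. P i m * (\<Sum>l=0..<n. Q m l * g l)) = g i" for g :: "nat \<Rightarrow> complex"
  proof -
    have "(\<Sum>m=0..<n. P i m * (\<Sum>l=0..<n. Q m l * g l)) = (\<Sum>m=0..<n. \<Sum>l=0..<n. P i m * Q m l * g l)"
      by (simp add: sum_distrib_left mult.assoc)
    also have "\<dots> = (\<Sum>l=0..<n. \<Sum>m=0..<n. P i m * Q m l * g l)"
      by (rule sum.swap)
    also have "\<dots> = (\<Sum>l=0..<n. (if i = l then 1 else 0) * g l)"
      using i by (intro sum.cong refl) (simp add: sum_distrib_right[symmetric] PQ)
    also have "\<dots> = g i"
      using i by (simp add: if_distrib[of "\<lambda>x. x * _"] cong: if_cong)
    finally show ?thesis .
  qed
  have "((\<lambda>t. \<Sum>m=0..<n. P i m * z m t) \<longlongrightarrow> (\<Sum>m=0..<n. P i m * 0)) at_top"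
    using zw by (intro tendsto_intros) auto
  then show "(e i \<longlongrightarrow> 0) at_top" by (simp add: z_def recover)
  have "((\<lambda>t. \<Sum>m=0..<n. P i m * w m t) \<longlongrightarrow> (\<Sum>m=0..<n. P i m * 0)) at_top"
    using zw by (intro tendsto_intros) auto
  then show "(d i \<longlongrightarrow> 0) at_top" by (simp add: w_def recover)
qed

subsection \<open>The Laplacian of a digraph\<close>

text \<open>An operator on vertex functions whose general codomain serves real states and complex
  eigenvectors alike; \<open>laplace_matrix_sum\<close> links it to the matrix.\<close>

definition laplacian :: "'a pair_pre_digraph \<Rightarrow> ('a \<Rightarrow> 'b::ab_group_add) \<Rightarrow> 'a \<Rightarrow> 'b" where
  "laplacian G f i = (\<Sum>j\<in>neighbours G i. f i - f j)"

lemma laplacian_add: "laplacian G (\<lambda>j. f j + g j) i = laplacian G f i + laplacian G g i"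
  by (simp add: laplacian_def sum.distrib[symmetric] algebra_simps)

lemma laplacian_minus: "laplacian G (\<lambda>j. - f j) i = - laplacian G f i"
  by (simp add: laplacian_def sum_negf[symmetric])

lemma laplacian_const: "laplacian G (\<lambda>j. c) i = 0"
  by (simp add: laplacian_def)

lemma bounded_linear_laplacian:
  "bounded_linear h \<Longrightarrow> laplacian G (\<lambda>j. h (f j)) i = h (laplacian G f i)"
  by (simp add: laplacian_def bounded_linear.linear linear_sum linear_diff)

lemma
  assumes "pair_digraph G"
  shows neighbours_subset: "neighbours G i \<subseteq> pverts G"
    and finite_neighbours: "finite (neighbours G i)"
    and pair_digraph_finite_pverts: "finite (pverts G)"
proof -
  interpret pair_digraph G by fact
  show fin: "finite (pverts G)" by (rule pair_finite_verts)
  show sub: "neighbours G i \<subseteq> pverts G" by (auto simp: neighbours_def dest: in_arcsD2)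
  show "finite (neighbours G i)" by (rule finite_subset[OF sub fin])
qed

text \<open>Tree paths are paths of \<open>G\<close>; maxima will be propagated along them.\<close>

lemma spanning_tree_root:
  assumes "contains_directed_spanning_tree G"
  shows "\<exists>r\<in>pverts G. \<forall>v\<in>pverts G. (v, r) \<in> (parcs G)\<^sup>*"
proof -
  from assms obtain T r where T: "directed_tree T r" "spanning (with_proj T) (with_proj G)"
    "\<forall>v \<in> pverts G. v \<rightarrow>\<^sup>*\<^bsub>with_proj T\<^esub> r"
    unfolding contains_directed_spanning_tree_def by blast
  have "parcs T \<subseteq> parcs G" "pverts T = pverts G"
    using T(2) by (auto simp: spanning_def subgraph_def)
  moreover have "arcs_ends (with_proj T) = parcs T"
    by (auto simp: arcs_ends_def arc_to_ends_def)
  moreover have "(v, r) \<in> (arcs_ends (with_proj T))\<^sup>*" if "v \<in> pverts G" for v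
    using T(3) that unfolding reachable_def by (blast intro: rtrancl_on_rtranclI)
  ultimately show ?thesis
    using T(1) rtrancl_mono[of "parcs T" "parcs G"] unfolding directed_tree_def by (intro bexI[of _ r]) auto
qed

section \<open>Maximum principle for the Laplacian\<close>

lemma laplacian_nonneg_at_max:
  fixes f :: "'a \<Rightarrow> real"
  assumes "pair_digraph G" "\<And>j. j \<in> pverts G \<Longrightarrow> f j \<le> f i"
  shows "laplacian G f i \<ge> 0"
  unfolding laplacian_def using neighbours_subset[OF assms(1)] assms(2)
  by (intro sum_nonneg) (auto simp: subset_iff)

lemma finite_ex_max:
  fixes f :: "'a \<Rightarrow> real"
  assumes "finite A" "A \<noteq> {}"
  obtains i where "i \<in> A" "\<And>j. j \<in> A \<Longrightarrow> f j \<le> f i"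
proof -
  have "Max (f ` A) \<in> f ` A" using assms by (intro Max_in) auto
  then obtain i where "i \<in> A" "f i = Max (f ` A)" by auto
  moreover from this have "f j \<le> f i" if "j \<in> A" for j
    using that assms(1) by simp
  ultimately show ?thesis using that by blast
qed

text \<open>A vertex attaining the maximum passes it on to all its neighbours, hence along a path to
  \<open>r\<close>.\<close>

lemma subharmonic_max_at_root:
  fixes f :: "'a \<Rightarrow> real"
  assumes G: "pair_digraph G"
    and root: "\<And>v. v \<in> pverts G \<Longrightarrow> (v, r) \<in> (parcs G)\<^sup>*"
    and sub: "\<And>v. v \<in> pverts G \<Longrightarrow> laplacian G f v \<le> 0"
    and j: "j \<in> pverts G"
  shows "f j \<le> f r"
proof -
  obtain i where i: "i \<in> pverts G" "\<And>j. j \<in> pverts G \<Longrightarrow> f j \<le> f i"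
    using finite_ex_max[OF pair_digraph_finite_pverts[OF G]] j by blast
  have "v \<in> pverts G \<and> f v = f i" if "(i, v) \<in> (parcs G)\<^sup>*" for v
    using that
  proof (induction rule: rtrancl_induct)
    case base
    then show ?case using i by simp
  next
    case (step v w)
    then have v: "v \<in> pverts G" "f v = f i" by auto
    have w: "w \<in> neighbours G v" using step by (simp add: neighbours_def)
    have nb: "u \<in> pverts G" if "u \<in> neighbours G v" for u
      using neighbours_subset[OF G] that by blast
    have nonneg: "0 \<le> f v - f u" if "u \<in> neighbours G v" for u
      using i(2)[OF nb[OF that]] v(2) by simp
    \<comment> \<open>Subharmonicity makes the sum nonpositive while its terms are nonnegative, so
      each term is zero.\<close>
    have "(\<Sum>u\<in>neighbours G v. f v - f u) = 0"
      using sub[OF v(1)] sum_nonneg[of "neighbours G v" "\<lambda>u. f v - f u"] nonneg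
      unfolding laplacian_def by fastforce
    then have "f v - f w = 0"
      using sum_nonneg_eq_0_iff[OF finite_neighbours[OF G], of v "\<lambda>u. f v - f u"] nonneg w by blast
    then show ?case using v nb[OF w] by simp
  qed
  from this[OF root[OF i(1)]] i(2)[OF j] show ?thesis by simp
qed

text \<open>A maximum gives \<open>c \<ge> 0\<close>, a minimum \<open>c \<le> 0\<close>. With
  \<open>c = 0\<close> both \<open>f\<close> and \<open>- f\<close> are subharmonic, so
  \<open>f r\<close> is the largest and the smallest value.\<close>

lemma constant_laplacian_imp_constant_real:
  fixes f :: "'a \<Rightarrow> real"
  assumes G: "pair_digraph G"
    and root: "\<And>v. v \<in> pverts G \<Longrightarrow> (v, r) \<in> (parcs G)\<^sup>*"
    and c: "\<And>v. v \<in> pverts G \<Longrightarrow> laplacian G f v = c"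
    and j: "j \<in> pverts G"
  shows "f j = f r"
proof -
  have ne: "pverts G \<noteq> {}" using j by blast
  obtain i where "i \<in> pverts G" "\<And>j. j \<in> pverts G \<Longrightarrow> f j \<le> f i"
    using finite_ex_max[OF pair_digraph_finite_pverts[OF G] ne] by blast
  then have "c \<ge> 0" using laplacian_nonneg_at_max[OF G, of f i] c by simp
  moreover obtain i where "i \<in> pverts G" "\<And>j. j \<in> pverts G \<Longrightarrow> - f j \<le> - f i"
    using finite_ex_max[OF pair_digraph_finite_pverts[OF G] ne, of "\<lambda>j. - f j"] by blast
  then have "c \<le> 0" using laplacian_nonneg_at_max[OF G, of "\<lambda>j. - f j" i] c by (simp add: laplacian_minus)
  ultimately have "c = 0" by simp
  then show ?thesis
    using subharmonic_max_at_root[OF G root _ j, of f]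
      subharmonic_max_at_root[OF G root _ j, of "\<lambda>j. - f j"] c
    by (simp add: laplacian_minus)
qed

lemma constant_laplacian_imp_constant:
  fixes f :: "'a \<Rightarrow> complex"
  assumes G: "pair_digraph G"
    and root: "\<And>v. v \<in> pverts G \<Longrightarrow> (v, r) \<in> (parcs G)\<^sup>*"
    and c: "\<And>v. v \<in> pverts G \<Longrightarrow> laplacian G f v = c"
    and j: "j \<in> pverts G"
  shows "f j = f r"
proof (rule complex_eqI)
  show "Re (f j) = Re (f r)"
    by (rule constant_laplacian_imp_constant_real[OF G root _ j, of _ "Re c"])
      (simp_all add: bounded_linear_laplacian[OF bounded_linear_Re] c)
  show "Im (f j) = Im (f r)"
    by (rule constant_laplacian_imp_constant_real[OF G root _ j, of _ "Im c"])
      (simp_all add: bounded_linear_laplacian[OF bounded_linear_Im] c)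
qed

text \<open>Up to the sign of \<open>f\<close> there is a positive maximum, where the Laplacian
  \<open>c * f i\<close> is nonnegative.\<close>

lemma laplacian_eigenvalue_nonneg:
  fixes f :: "'a \<Rightarrow> real"
  assumes G: "pair_digraph G"
    and eig: "\<And>v. v \<in> pverts G \<Longrightarrow> laplacian G f v = c * f v"
    and j: "j \<in> pverts G" "f j \<noteq> 0"
  shows "c \<ge> 0"
proof -
  have pos: "c \<ge> 0" if g: "\<And>v. v \<in> pverts G \<Longrightarrow> laplacian G g v = c * g v" "g j > 0" for g :: "'a \<Rightarrow> real"
  proof -
    obtain i where i: "i \<in> pverts G" "\<And>j. j \<in> pverts G \<Longrightarrow> g j \<le> g i"
      using finite_ex_max[OF pair_digraph_finite_pverts[OF G]] j by blast
    then have "0 \<le> c * g i" using laplacian_nonneg_at_max[OF G, of g i] g(1) by simp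
    moreover have "g i > 0" using i(2)[OF j(1)] g(2) by linarith
    ultimately show ?thesis by (simp add: zero_le_mult_iff)
  qed
  show ?thesis
  proof (cases "f j > 0")
    case True
    then show ?thesis using pos[of f] eig by blast
  next
    case False
    then show ?thesis using pos[of "\<lambda>j. - f j"] eig j(2) by (simp add: laplacian_minus)
  qed
qed

section \<open>Spectral properties of the Laplace matrix\<close>

lemma laplace_matrix_index:
  assumes G: "pair_digraph G" "pverts G = {0..<N}" and ij: "i < N" "j < N"
  shows "laplace_matrix N G $$ (i, j) =
    (if i = j then real (card (neighbours G i)) else 0) - (if (i, j) \<in> parcs G then 1 else 0)"
proof -
  have "{0..<N} \<inter> {j. (i, j) \<in> parcs G} = neighbours G i"
    using neighbours_subset[OF G(1), of i] G(2) by (auto simp: neighbours_def)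
  then have "vec_index (adjacency_matrix N G *\<^sub>v Matrix.vec N (\<lambda>_. 1)) i = real (card (neighbours G i))"
    using ij by (simp add: adjacency_matrix_def scalar_prod_def sum.If_cases)
  then show ?thesis
    using ij by (auto simp: laplace_matrix_def adjacency_matrix_def mat_diag_def)
qed

lemma laplace_matrix_sum:
  fixes f :: "nat \<Rightarrow> 'b::real_algebra_1"
  assumes G: "pair_digraph G" "pverts G = {0..<N}" and i: "i < N"
  shows "(\<Sum>j=0..<N. of_real (laplace_matrix N G $$ (i, j)) * f j) = laplacian G f i"
proof -
  have nb: "{0..<N} \<inter> {j. (i, j) \<in> parcs G} = neighbours G i"
    using neighbours_subset[OF G(1), of i] G(2) by (auto simp: neighbours_def)
  have "(\<Sum>j=0..<N. of_real (laplace_matrix N G $$ (i, j)) * f j) =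
      (\<Sum>j=0..<N. (if i = j then of_nat (card (neighbours G i)) * f j else 0)
        - (if (i, j) \<in> parcs G then f j else 0))"
    using i by (intro sum.cong refl) (auto simp: laplace_matrix_index[OF G] left_diff_distrib)
  also have "\<dots> = of_nat (card (neighbours G i)) * f i - (\<Sum>j\<in>neighbours G i. f j)"
    using i by (simp add: sum_subtractf sum.If_cases nb)
  also have "\<dots> = laplacian G f i"
    by (simp add: laplacian_def sum_subtractf)
  finally show ?thesis .
qed

text \<open>Once \<open>\<mu>\<close> is real, the real and imaginary parts of \<open>w\<close> both
  satisfy the eigenvalue equation, and one of them is nonzero.\<close>

lemma real_laplacian_eigenvalue:
  fixes w :: "nat \<Rightarrow> complex"
  assumes G: "pair_digraph G" "pverts G = {0..<N}"
    and spec: "has_real_spectrum (laplace_matrix N G)"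
    and eig: "\<And>i. i < N \<Longrightarrow> laplacian G w i = \<mu> * w i"
    and w: "j < N" "w j \<noteq> 0"
  shows "\<mu> \<in> \<real>" "Re \<mu> \<ge> 0"
    "\<exists>f. (\<exists>i<N. f i \<noteq> 0) \<and> (\<forall>i<N. laplacian G f i = Re \<mu> * f i)"
proof -
  have L: "laplace_matrix N G \<in> carrier_mat N N"
    by (intro carrier_matI) (simp_all add: laplace_matrix_def adjacency_matrix_def)
  have "eigenvector (map_mat complex_of_real (laplace_matrix N G)) (Matrix.vec N w) \<mu>"
    unfolding eigenvector_def
  proof (intro conjI)
    show "Matrix.vec N w \<in> carrier_vec (dim_row (map_mat complex_of_real (laplace_matrix N G)))"
      using L by simp
    show "Matrix.vec N w \<noteq> 0\<^sub>v (dim_row (map_mat complex_of_real (laplace_matrix N G)))"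
    proof
      assume "Matrix.vec N w = 0\<^sub>v (dim_row (map_mat complex_of_real (laplace_matrix N G)))"
      then have "vec_index (Matrix.vec N w) j = 0" using w L by simp
      then show False using w by simp
    qed
    show "map_mat complex_of_real (laplace_matrix N G) *\<^sub>v Matrix.vec N w = \<mu> \<cdot>\<^sub>v Matrix.vec N w"
    proof (rule eq_vecI)
      fix i assume "i < dim_vec (\<mu> \<cdot>\<^sub>v Matrix.vec N w)"
      then have i: "i < N" by simp
      have "vec_index (map_mat complex_of_real (laplace_matrix N G) *\<^sub>v Matrix.vec N w) i =
          (\<Sum>j=0..<N. of_real (laplace_matrix N G $$ (i, j)) * w j)"
        using L i by (simp add: scalar_prod_def)
      also have "\<dots> = \<mu> * w i"
        using laplace_matrix_sum[OF G i, of w] eig[OF i] by simp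
      finally show "vec_index (map_mat complex_of_real (laplace_matrix N G) *\<^sub>v Matrix.vec N w) i =
          vec_index (\<mu> \<cdot>\<^sub>v Matrix.vec N w) i" using i by simp
    qed (use L in simp)
  qed
  then show real: "\<mu> \<in> \<real>"
    using spec unfolding has_real_spectrum_def spectrum_def eigenvalue_def by auto
  have mu: "\<mu> = of_real (Re \<mu>)" using real by simp
  have "laplacian G (\<lambda>i. Re (w i)) i = Re \<mu> * Re (w i)"
    "laplacian G (\<lambda>i. Im (w i)) i = Re \<mu> * Im (w i)" if "i < N" for i
    by (simp_all add: bounded_linear_laplacian[OF bounded_linear_Re]
        bounded_linear_laplacian[OF bounded_linear_Im] eig[OF that] real complex_is_Real_iff[THEN iffD1])
  moreover have "Re (w j) \<noteq> 0 \<or> Im (w j) \<noteq> 0"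
    using w(2) by (auto simp: complex_eq_iff)
  ultimately show ex: "\<exists>f. (\<exists>i<N. f i \<noteq> 0) \<and> (\<forall>i<N. laplacian G f i = Re \<mu> * f i)"
    using w(1) by metis
  then show "Re \<mu> \<ge> 0"
    using laplacian_eigenvalue_nonneg[OF G(1)] G(2) by fastforce
qed

text \<open>Row \<open>r\<close> reads \<open>v r = \<mu> * v r\<close>, so
  \<open>v r \<noteq> 0\<close> forces \<open>\<mu> = 1\<close>. If \<open>v r = 0\<close>, then
  \<open>\<mu>\<close> turns out to be a nonzero eigenvalue of the Laplacian itself.\<close>

lemma grounded_laplacian_spectrum_positive:
  fixes v :: "nat \<Rightarrow> complex"
  assumes G: "pair_digraph G" "pverts G = {0..<N}"
    and spec: "has_real_spectrum (laplace_matrix N G)"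
    and root: "\<And>v. v \<in> pverts G \<Longrightarrow> (v, r) \<in> (parcs G)\<^sup>*" and r: "r < N"
    and eig: "\<And>i. i < N \<Longrightarrow>
      laplacian G v i - laplacian G v r + (if i = r then v r else 0) = \<mu> * v i"
    and v: "j < N" "v j \<noteq> 0"
  shows "\<mu> \<in> \<real> \<and> Re \<mu> > 0"
proof (cases "v r = 0")
  case False
  then have "\<mu> = 1" using eig[OF r] by simp
  then show ?thesis by simp
next
  case True
  define c where "c = laplacian G v r"
  have lap: "laplacian G v i = \<mu> * v i + c" if "i < N" for i
    using eig[OF that] True by (auto simp: c_def algebra_simps split: if_splits)
  \<comment> \<open>For \<open>\<mu> = 0\<close> the Laplacian of \<open>v\<close> would be
    constant, making \<open>v\<close> constant and equal to \<open>v r = 0\<close>.\<close>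
  have mu: "\<mu> \<noteq> 0"
  proof
    assume "\<mu> = 0"
    then have "v j = v r"
      using constant_laplacian_imp_constant[OF G(1) root, of v c j] lap v(1) G(2) by simp
    then show False using v True by simp
  qed
  \<comment> \<open>Constants lie in the kernel of the Laplacian, so this shift turns \<open>v\<close> into an eigenvector.\<close>
  define w where "w i = v i + c / \<mu>" for i
  have w: "laplacian G w i = \<mu> * w i" if "i < N" for i
    unfolding w_def using mu lap[OF that]
    by (simp add: laplacian_add laplacian_const distrib_left)
  \<comment> \<open>If \<open>w r = 0\<close>, the shift \<open>c / \<mu>\<close> is zero because
    \<open>v r = 0\<close>, and \<open>w\<close> agrees with \<open>v\<close>.\<close>
  obtain l where l: "l < N" "w l \<noteq> 0"
  proof (cases "w r = 0")
    case True
    then have "w j = v j" using \<open>v r = 0\<close> by (simp add: w_def)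
    then show ?thesis using that v by simp
  qed (use r that in blast)
  from real_laplacian_eigenvalue(1,2)[OF G spec w l] mu show ?thesis
    by (auto simp: complex_is_Real_iff complex_eq_iff order_less_le)
qed

text \<open>The trace counts the arcs and is nonzero, so some diagonal entry of \<open>T\<close> is
  nonzero; being real and nonnegative, it is positive.\<close>

lemma positive_laplacian_eigenvalue_exists:
  assumes G: "pair_digraph G" "pverts G = {0..<N}"
    and spec: "has_real_spectrum (laplace_matrix N G)"
    and arc: "(a, b) \<in> parcs G"
  obtains f :: "nat \<Rightarrow> real" and c i j
  where "c > 0" "\<And>i. i < N \<Longrightarrow> laplacian G f i = c * f i" "i < N" "j < N" "f i \<noteq> f j"
proof -
  define A where "A i j = complex_of_real (laplace_matrix N G $$ (i, j))" for i j
  obtain P Q T :: "nat \<Rightarrow> nat \<Rightarrow> complex"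
    where "\<forall>i<N. \<forall>j<N. (\<Sum>l=0..<N. P i l * Q l j) = (if i = j then 1 else 0)"
      and "\<forall>i<N. \<forall>j<N. (\<Sum>l=0..<N. Q i l * P l j) = (if i = j then 1 else 0)"
      and "\<forall>i<N. \<forall>j<N. (\<Sum>l=0..<N. Q i l * A l j) = (\<Sum>l=0..<N. T i l * Q l j)"
      and "\<forall>i<N. \<forall>j<i. T i j = 0"
      and "\<forall>i<N. \<exists>v. (\<exists>j<N. v j \<noteq> 0) \<and> (\<forall>j<N. (\<Sum>l=0..<N. A j l * v l) = T i i * v j)"
    using triangularization[of N A] by (elim exE conjE)
  note PQ = this(1)[rule_format] and QP = this(2)[rule_format] and QA = this(3)[rule_format]
    and ev = this(5)[rule_format]
  have loopfree: "(i, i) \<notin> parcs G" for i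
  proof -
    interpret pair_digraph G by fact
    show ?thesis using pair_no_loops[of "(i, i)"] by auto
  qed
  have A: "A i i = of_nat (card (neighbours G i))" if "i < N" for i
    using that loopfree by (simp add: A_def laplace_matrix_index[OF G])
  have "a < N"
  proof -
    interpret pair_digraph G by fact
    show ?thesis using in_arcsD1[OF arc] G(2) by simp
  qed
  moreover have "b \<in> neighbours G a" using arc by (simp add: neighbours_def)
  ultimately have "(\<Sum>i=0..<N. card (neighbours G i)) \<noteq> 0"
    using finite_neighbours[OF G(1)] by (auto simp: card_eq_0_iff)
  then have "(\<Sum>i=0..<N. A i i) \<noteq> 0"
    by (simp add: A of_nat_sum[symmetric] del: of_nat_sum)
  then have "(\<Sum>i=0..<N. T i i) \<noteq> 0"
    using trace_triangularization[OF PQ QP QA] by simp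
  then obtain i where "i \<in> {0..<N}" and Ti: "T i i \<noteq> 0"
    by (rule sum.not_neutral_contains_not_neutral)
  then have i: "i < N" by simp
  from ev[OF i] obtain v j where v: "j < N" "v j \<noteq> 0"
    "\<And>j. j < N \<Longrightarrow> (\<Sum>l=0..<N. A j l * v l) = T i i * v j" by blast
  have "laplacian G v j = T i i * v j" if "j < N" for j
    using v(3)[OF that] laplace_matrix_sum[OF G that, of v] by (simp add: A_def)
  note eig = real_laplacian_eigenvalue[OF G spec this v(1,2)]
  define c where "c = Re (T i i)"
  have c: "c > 0" using eig(1,2) Ti
    by (auto simp: c_def complex_is_Real_iff complex_eq_iff order_less_le)
  from eig(3) obtain f m where f: "m < N" "f m \<noteq> 0" "\<And>i. i < N \<Longrightarrow> laplacian G f i = c * f i"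
    unfolding c_def by blast
  \<comment> \<open>A constant vector lies in the kernel, contradicting
    \<open>c * f m \<noteq> 0\<close>.\<close>
  have "\<exists>j<N. f m \<noteq> f j"
  proof (rule ccontr)
    assume "\<not> ?thesis"
    then have "laplacian G f m = 0"
      using neighbours_subset[OF G(1), of m] G(2) unfolding laplacian_def
      by (intro sum.neutral) auto
    then show False using f c by simp
  qed
  then show ?thesis using that[OF c f(3) f(1)] by blast
qed

subsection \<open>Synchronization\<close>

text \<open>For \<open>b \<le> 0\<close> the discriminant is nonnegative, and so is the larger root
  \<open>(D - b) / 2\<close>.\<close>

lemma nonneg_characteristic_root_exists:
  fixes b :: real
  assumes "b \<le> 0"
  obtains s where "s \<ge> 0" "s * s + b * s + b = 0"
proof -
  define D where "D = sqrt (b\<^sup>2 - 4 * b)"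
  have "b\<^sup>2 - 4 * b \<ge> 0" using assms zero_le_power2[of b] by linarith
  then have D: "D * D = b\<^sup>2 - 4 * b" "D \<ge> 0"
    by (simp_all add: D_def)
  define s where "s = (D - b) / 2"
  have "s \<ge> 0" using D(2) assms by (simp add: s_def)
  moreover have "s * s + b * s + b = (D * D - (b\<^sup>2 - 4 * b)) / 4"
    by (simp add: s_def field_simps power2_eq_square)
  then have "s * s + b * s + b = 0" using D(1) by simp
  ultimately show ?thesis by (rule that)
qed

section \<open>Closed-loop equations of the given agents and the two implications\<close>

context
  fixes A :: "real^2^2" and B C :: "real^2"
  assumes A: "A = vector [vector [0, 0], vector [1, 0]]"
    and B: "B = vector [2, 0]"
    and C: "C = vector [0.5, 0.5]"
begin

lemma agent_vector_field:
  "(A *v z + v *\<^sub>R B) $ 1 = 2 * v" "(A *v z + v *\<^sub>R B) $ 2 = z $ 1"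
  by (simp_all add: A B matrix_vector_mult_def sum_2)

lemma agent_output: "inner C z = (z $ 1 + z $ 2) / 2"
  by (simp add: C inner_vec_def sum_2)

text \<open>The input factor 2 cancels the output factor 1/2.\<close>

lemma closed_loop_components:
  assumes G: "pair_digraph G" and cl: "closed_loop G A B C k x u y"
    and i: "i \<in> pverts G" and t: "t \<ge> 0"
  shows "((\<lambda>t. x i t $ 2) has_vector_derivative x i t $ 1) (at t within {0..})"
    and "((\<lambda>t. x i t $ 1) has_vector_derivative
      - k * laplacian G (\<lambda>j. x j t $ 1 + x j t $ 2) i) (at t within {0..})"
proof -
  have x: "(x i has_vector_derivative (A *v x i t + u i t *\<^sub>R B)) (at t within {0..})"
    and u: "u i t = - k * (\<Sum>j \<in> neighbours G i. y i t - y j t)"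
    using cl i t unfolding closed_loop_def by blast+
  have y: "y j t = (x j t $ 1 + x j t $ 2) / 2" if "j \<in> pverts G" for j
    using cl that t unfolding closed_loop_def agent_output by blast
  note comp = bounded_linear.has_vector_derivative[OF bounded_linear_vec_nth x]
  show "((\<lambda>t. x i t $ 2) has_vector_derivative x i t $ 1) (at t within {0..})"
    using comp[of 2] unfolding agent_vector_field .
  have "(\<Sum>j \<in> neighbours G i. y i t - y j t) =
      (\<Sum>j \<in> neighbours G i. ((x i t $ 1 + x i t $ 2) - (x j t $ 1 + x j t $ 2)) / 2)"
    using neighbours_subset[OF G, of i] i
    by (intro sum.cong refl) (auto simp: y diff_divide_distrib)
  then have "2 * u i t = - k * laplacian G (\<lambda>j. x j t $ 1 + x j t $ 2) i"
    unfolding u laplacian_def by (simp add: sum_divide_distrib[symmetric])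
  then show "((\<lambda>t. x i t $ 1) has_vector_derivative
      - k * laplacian G (\<lambda>j. x j t $ 1 + x j t $ 2) i) (at t within {0..})"
    using comp[of 1] unfolding agent_vector_field by simp
qed

text \<open>The differences to a root agent \<open>r\<close> form a network with positive spectrum
  and vanish; any two agents are compared through \<open>r\<close>.\<close>

lemma positive_gain_synchronizes:
  assumes G: "pair_digraph G" "pverts G = {0..<N}"
    and tree: "contains_directed_spanning_tree G"
    and spec: "has_real_spectrum (laplace_matrix N G)"
    and k: "k > 0"
  shows "ensures_synchronization G A B C k"
  unfolding ensures_synchronization_def
proof (intro allI impI ballI)
  fix x0 x u y i j
  assume "closed_loop G A B C k x u y \<and> (\<forall>i\<in>pverts G. x i 0 = x0 i)"
  then have cl: "closed_loop G A B C k x u y" ..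
  assume ij: "i \<in> pverts G" "j \<in> pverts G"
  obtain r where r: "r \<in> pverts G" and root: "\<And>v. v \<in> pverts G \<Longrightarrow> (v, r) \<in> (parcs G)\<^sup>*"
    using spanning_tree_root[OF tree] by blast
  have rN: "r < N" using r G(2) by simp
  \<comment> \<open>\<open>M\<close> governs the differences to agent \<open>r\<close>; its last summand moves the eigenvalue belonging to the
    identically zero component \<open>r\<close> from \<open>0\<close> to \<open>1\<close>.\<close>
  define M where "M i l = complex_of_real (laplace_matrix N G $$ (i, l))
    - of_real (laplace_matrix N G $$ (r, l)) + (if i = r \<and> l = r then 1 else 0)" for i l
  have M: "(\<Sum>l=0..<N. M i l * f l) = laplacian G f i - laplacian G f r + (if i = r then f r else 0)"
    if "i < N" for f i
  proof -
    have "(\<Sum>l=0..<N. M i l * f l) = (\<Sum>l=0..<N. complex_of_real (laplace_matrix N G $$ (i, l)) * f l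
        - of_real (laplace_matrix N G $$ (r, l)) * f l + (if l = r then (if i = r then f r else 0) else 0))"
      by (intro sum.cong refl) (auto simp: M_def algebra_simps)
    also have "\<dots> = laplacian G f i - laplacian G f r + (if i = r then f r else 0)"
      using rN by (simp add: sum.distrib sum_subtractf laplace_matrix_sum[OF G that]
          laplace_matrix_sum[OF G rN])
    finally show ?thesis .
  qed
  define e where "e i t = complex_of_real (x i t $ 2 - x r t $ 2)" for i t
  define d where "d i t = complex_of_real (x i t $ 1 - x r t $ 1)" for i t
  have spec_M: "\<mu> \<in> \<real> \<and> Re \<mu> > 0"
    if "\<exists>j<N. v j \<noteq> 0" "\<forall>j<N. (\<Sum>l=0..<N. M j l * v l) = \<mu> * v j" for v \<mu>
    using that grounded_laplacian_spectrum_positive[OF G spec root rN] by (auto simp: M)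
  have e: "(e i has_vector_derivative d i t) (at t within {0..})"
    and d: "(d i has_vector_derivative - of_real k * (\<Sum>l=0..<N. M i l * (d l t + e l t)))
        (at t within {0..})" if i: "i < N" and t: "t \<ge> 0" for i t
  proof -
    have iG: "i \<in> pverts G" using i G(2) by simp
    note deriv = closed_loop_components[OF G(1) cl _ t]
    show "(e i has_vector_derivative d i t) (at t within {0..})"
      unfolding e_def d_def
      by (intro bounded_linear.has_vector_derivative[OF bounded_linear_of_real]
          has_vector_derivative_diff deriv(1) iG r)
    let ?L = "laplacian G (\<lambda>j. x j t $ 1 + x j t $ 2)"
    have "(d i has_vector_derivative complex_of_real (- k * ?L i - - k * ?L r)) (at t within {0..})"
      unfolding d_def
      by (intro bounded_linear.has_vector_derivative[OF bounded_linear_of_real]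
          has_vector_derivative_diff deriv(2) iG r)
    also have "complex_of_real (- k * ?L i - - k * ?L r)
        = - of_real k * (of_real (?L i) - of_real (?L r))"
      by (simp add: algebra_simps)
    also have "of_real (?L i) - of_real (?L r) = (\<Sum>l=0..<N. M i l * (d l t + e l t))"
    proof -
      \<comment> \<open>Subtracting the state of agent \<open>r\<close> shifts all vertices equally,
        which the Laplacian does not see. The extra summand of \<open>M\<close> contributes zero
        since \<open>d r\<close> and \<open>e r\<close> vanish.\<close>
      have "laplacian G (\<lambda>l. d l t + e l t) i = of_real (?L i)" for i
        by (simp add: laplacian_def d_def e_def algebra_simps)
      then show ?thesis unfolding M[OF i] by (simp add: d_def e_def)
    qed
    finally show "(d i has_vector_derivative - of_real k * (\<Sum>l=0..<N. M i l * (d l t + e l t)))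
        (at t within {0..})" .
  qed
  have lim: "(e i \<longlongrightarrow> 0) at_top" "(d i \<longlongrightarrow> 0) at_top" if i: "i < N" for i
    by (rule positive_spectrum_network_tendsto_0[where M = M and e = e and d = d and n = N and i = i, OF k];
        use spec_M e d i in blast)+
  have *: "((\<lambda>t. x i t $ m - x r t $ m) \<longlongrightarrow> 0) at_top" if "i \<in> pverts G" for i m
  proof -
    have "i < N" using that G(2) by simp
    from lim[OF this, THEN tendsto_Re] show ?thesis
      using exhaust_2[of m] by (auto simp: e_def d_def)
  qed
  show "((\<lambda>t. x i t - x j t) \<longlongrightarrow> 0) at_top"
  proof (rule vec_tendstoI)
    fix m
    show "((\<lambda>t. (x i t - x j t) $ m) \<longlongrightarrow> 0 $ m) at_top"
      using tendsto_diff[OF *[OF ij(1), of m] *[OF ij(2), of m]] by simp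
  qed
qed

lemma synchronization_imp_positive_gain:
  assumes G: "pair_digraph G" "pverts G = {0..<N}" and N: "N \<ge> 2"
    and tree: "contains_directed_spanning_tree G"
    and spec: "has_real_spectrum (laplace_matrix N G)"
    and sync: "ensures_synchronization G A B C k"
  shows "k > 0"
proof (rule ccontr)
  assume "\<not> k > 0"
  obtain r where root: "\<And>v. v \<in> pverts G \<Longrightarrow> (v, r) \<in> (parcs G)\<^sup>*"
    using spanning_tree_root[OF tree] by blast
  \<comment> \<open>A second vertex exists as \<open>N \<ge> 2\<close>; the first arc on its path to
    \<open>r\<close> makes the trace nonzero.\<close>
  obtain a where "a < N" "a \<noteq> r"
    using N by (metis One_nat_def less_2_cases_iff order_less_le_trans zero_neq_one)
  then have "(a, r) \<in> (parcs G)\<^sup>*" "a \<noteq> r" using root[of a] G(2) by auto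
  then obtain b where "(a, b) \<in> parcs G" by (meson converse_rtranclE)
  then obtain f :: "nat \<Rightarrow> real" and c i j where c: "c > 0"
    and f: "\<And>i. i < N \<Longrightarrow> laplacian G f i = c * f i" and ij: "i < N" "j < N" "f i \<noteq> f j"
    using positive_laplacian_eigenvalue_exists[OF G spec] by metis
  have "k * c \<le> 0" using \<open>\<not> k > 0\<close> c by (simp add: mult_le_0_iff)
  then obtain s where s: "s \<ge> 0" "s * s + k * c * s + k * c = 0"
    by (rule nonneg_characteristic_root_exists)
  \<comment> \<open>The mode along \<open>f\<close>: the vector \<open>[s, 1]\<close> encodes that
    the first component is the derivative of the second.\<close>
  define x :: "nat \<Rightarrow> real \<Rightarrow> real^2" where "x i t = (f i * exp (s * t)) *\<^sub>R vector [s, 1]" for i t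
  define y where "y i t = inner C (x i t)" for i t
  define u where "u i t = - k * (\<Sum>j \<in> neighbours G i. y i t - y j t)" for i t
  have y: "y i t = f i * (exp (s * t) * (s + 1) / 2)" for i t
    by (simp add: y_def agent_output x_def algebra_simps)
  have u: "2 * u i t = s * s * f i * exp (s * t)" if "i < N" for i t
  proof -
    have "(\<Sum>j \<in> neighbours G i. y i t - y j t) = laplacian G f i * (exp (s * t) * (s + 1) / 2)"
      unfolding y laplacian_def sum_distrib_right left_diff_distrib ..
    then have "2 * u i t = - (k * c * s + k * c) * (f i * exp (s * t))"
      unfolding u_def f[OF that] by (simp add: algebra_simps)
    \<comment> \<open>The characteristic equation matches the feedback with the derivative of the
      first component.\<close>
    also have "- (k * c * s + k * c) = s * s" using s(2) by linarith
    finally show ?thesis by simp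
  qed
  have "closed_loop G A B C k x u y"
    unfolding closed_loop_def
  proof (intro ballI allI impI conjI)
    fix i and t :: real assume "i \<in> pverts G" and t: "t \<ge> 0"
    then have i: "i < N" using G(2) by simp
    have "((\<lambda>t. f i * exp (s * t)) has_real_derivative f i * exp (s * t) * s) (at t within {0..})"
      by (auto intro!: derivative_eq_intros)
    from has_vector_derivative_scaleR[OF this has_vector_derivative_const]
    have "(x i has_vector_derivative (f i * exp (s * t) * s) *\<^sub>R vector [s, 1]) (at t within {0..})"
      unfolding x_def by simp
    also have "(f i * exp (s * t) * s) *\<^sub>R vector [s, 1] = A *v x i t + u i t *\<^sub>R B"
      unfolding Finite_Cartesian_Product.vec_eq_iff forall_2 agent_vector_field u[OF i] by (simp add: x_def)
    finally show "(x i has_vector_derivative A *v x i t + u i t *\<^sub>R B) (at t within {0..})" .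
  qed (simp_all add: y_def u_def)
  then have "((\<lambda>t. x i t - x j t) \<longlongrightarrow> 0) at_top"
    using sync[unfolded ensures_synchronization_def, rule_format, of x u y "\<lambda>i. x i 0" i j] ij G(2)
    by simp
  \<comment> \<open>The second component is used because the first vanishes identically when
    \<open>s = 0\<close>, which happens for \<open>k = 0\<close>.\<close>
  from tendsto_norm[OF tendsto_vec_nth[OF this, of 2]]
  have "((\<lambda>t. \<bar>f i - f j\<bar> * exp (s * t)) \<longlongrightarrow> 0) at_top"
    by (simp add: x_def left_diff_distrib[symmetric] abs_mult)
  moreover have "\<forall>\<^sub>F t in at_top. \<bar>f i - f j\<bar> \<le> \<bar>f i - f j\<bar> * exp (s * t)"
    using eventually_ge_at_top[of 0]
  proof eventually_elim
    case (elim t)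
    then have "1 \<le> exp (s * t)" using s(1) by simp
    then show ?case by (simp add: mult_le_cancel_left1)
  qed
  ultimately have "\<bar>f i - f j\<bar> \<le> 0"
    by (rule tendsto_lowerbound) simp
  then show False using ij(3) by simp
qed

end

theorem theorem4:
  fixes N :: nat and k :: real
    and G :: "nat pair_pre_digraph"
    and A :: "real^2^2" and B C :: "real^2"
  assumes "N \<ge> 2"
    and "pair_digraph G" and "pverts G = {0..<N}"
    and "contains_directed_spanning_tree G"
    and "has_real_spectrum (laplace_matrix N G)"
    and "A = vector [vector [0, 0], vector [1, 0]]"
    and "B = vector [2, 0]"
    and "C = vector [0.5, 0.5]"
  shows "ensures_synchronization G A B C k \<longleftrightarrow> k > 0"
  using positive_gain_synchronizes[OF assms(6,7,8,2,3,4,5)]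
    synchronization_imp_positive_gain[OF assms(6,7,8,2,3,1,4,5)] by blast

end
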